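(* Assume $\Vert \ell'(\cdot)\Vert\le c_1$. Let $\epsilon\in(0,1]$ be arbitrary and let $\boldsymbol{\xi}_i^k$ be sampled from the Gaussian mechanism with variance $\sigma_{i,k}^2$, where $$\sigma_{i,k}=\frac{2c_1\sqrt{2\ln(1.25/\delta)}}{m_i\,\epsilon\,(\rho+1/\eta_i^k)} .$$ Then the DP-ADMM algorithm (run for $t$ iterations) guarantees $(\bar{\epsilon},\delta)$-differential privacy, where $\bar{\epsilon}=c_0\sqrt{t}\,\epsilon$ for some constant $c_0$.
   Context: There are $n$ agents; agent $i\in[n]=\{1,\dots,n\}$ holds a private dataset $\mathcal{D}_i=\{(\boldsymbol{a}_{i,j},\boldsymbol{b}_{i,j}):j\in[m_i]\}$ with $\boldsymbol{a}_{i,j}\in\mathbb{R}^d$, $\boldsymbol{b}_{i,j}\in\mathbb{R}^p$. The loss $\ell:\mathbb{R}^d\times\mathbb{R}^p\times\mathbb{R}^{d\times p}\to\mathbb{R}$ and the regularizer $R:\mathbb{R}^{d\times p}\to\mathbb{R}$ are convex in the model variable $\boldsymbol{w}\in\mathbb{R}^{d\times p}$ but not necessarily smooth; $\ell'$ and $R'$ denote (fixed selections of) subgradients with respect to $\boldsymbol{w}$. Here $\lambda>0$, $\rho>0$, $\delta\in(0,1)$, and $\eta_i^k>0$ are step sizes (decreasing in $k$). Norms and inner products on $\mathbb{R}^{d\times p}$ are Euclidean ($l_2$, i.e. Frobenius). Put $f_i(\boldsymbol{w})=\sum_{j=1}^{m_i}\frac1{m_i}\ell(\boldsymbol{a}_{i,j},\boldsymbol{b}_{i,j},\boldsymbol{w})+\frac{\lambda}{n}R(\boldsymbol{w})$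 and $f_i'(\boldsymbol{w})=\sum_{j=1}^{m_i}\frac1{m_i}\ell'(\boldsymbol{a}_{i,j},\boldsymbol{b}_{i,j},\boldsymbol{w})+\frac{\lambda}{n}R'(\boldsymbol{w})$, and define $$\hat{\mathcal{L}}_{\rho,k,i}(\boldsymbol{w}_i,\tilde{\boldsymbol{w}}_i^{k-1},\boldsymbol{w},\boldsymbol{\gamma}_i)=f_i(\tilde{\boldsymbol{w}}_i^{k-1})+\langle f_i'(\tilde{\boldsymbol{w}}_i^{k-1}),\boldsymbol{w}_i-\tilde{\boldsymbol{w}}_i^{k-1}\rangle-\langle\boldsymbol{\gamma}_i,\boldsymbol{w}_i-\boldsymbol{w}\rangle+\frac{\rho}{2}\Vert\boldsymbol{w}_i-\boldsymbol{w}\Vert^2+\frac{\Vert\boldsymbol{w}_i-\tilde{\boldsymbol{w}}_i^{k-1}\Vert^2}{2\eta_i^k}.$$ DP-ADMM: initialize $\boldsymbol{w}^0$, $\{\tilde{\boldsymbol{w}}_i^0\}$, $\{\boldsymbol{\gamma}_i^0\}$ in $\mathbb{R}^{d\times p}$; for $k=1,\dots,t$: each agent $i$ computes $\boldsymbol{w}_i^k=\arg\min_{\boldsymbol{w}_i}\hat{\mathcal{L}}_{\rho,k,i}(\boldsymbol{w}_i,\tilde{\boldsymbol{w}}_i^{k-1},\boldsymbol{w}^{k-1},\boldsymbol{\gamma}_i^{k-1})$, samples fresh independent Gaussian noise $\boldsymbol{\xi}_i^k\in\mathbb{R}^{d\times p}$ and sets $\tilde{\boldsymbol{w}}_i^k=\boldsymbol{w}_i^k+\boldsymbol{\xi}_i^k$;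 then $\boldsymbol{w}^k=\frac1n\sum_{i=1}^n\tilde{\boldsymbol{w}}_i^k-\frac1n\sum_{i=1}^n\boldsymbol{\gamma}_i^{k-1}/\rho$ and $\boldsymbol{\gamma}_i^k=\boldsymbol{\gamma}_i^{k-1}-\rho(\tilde{\boldsymbol{w}}_i^k-\boldsymbol{w}^k)$. "Gaussian mechanism with variance $\sigma_{i,k}^2$" means that the entries of $\boldsymbol{\xi}_i^k$ are i.i.d. $\mathcal{N}(0,\sigma_{i,k}^2)$. For each agent $i$, the algorithm is regarded as the ($t$-fold adaptive) randomized mechanism taking $\mathcal{D}_i$ to the outputs $\{\tilde{\boldsymbol{w}}_i^k\}_{k\in[t]}$ shared by agent $i$. A randomized mechanism $\mathcal{M}$ is $(\epsilon,\delta)$-differentially private if for any two neighbouring datasets $\mathcal{D},\mathcal{D}'$ (of the same size, differing in only one tuple) and any (measurable) set of outputs $\mathcal{O}$, $\Pr[\mathcal{M}(\mathcal{D})\in\mathcal{O}]\le e^{\epsilon}\Pr[\mathcal{M}(\mathcal{D}')\in\mathcal{O}]+\delta$.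
   Formalization: With c_0 independent of t the claim is false (t-fold Gaussian composition); here c_0 may depend on t, or only on B (uniformly in t) when sqrt(t)*epsilon <= B*ln(1.25/delta). c_0 is chosen for fixed d and p, and the subgradient selections are assumed Borel measurable. *)

theory Defs
  imports "HOL-Probability.Probability"
begin

text \<open>A model is a matrix with rows indexed by \<open>'d\<close> and columns by \<open>'p\<close>; \<open>norm\<close> and
  \<open>\<bullet>\<close> on this type are the Frobenius norm and inner product.\<close>

type_synonym ('d, 'p) model = "real ^ 'p ^ 'd"
type_synonym ('d, 'p) dataset = "((real ^ 'd) \<times> (real ^ 'p)) list"

text \<open>Agents are \<open>1, \<dots>, agents\<close>, and \<open>data P i\<close> is the private dataset of agent \<open>i\<close>, whose
  size is its length. \<open>loss_sub\<close> and \<open>reg_sub\<close> are the chosen subgradients with respect to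
  the model. \<open>step P i k\<close> is used in iteration \<open>k \<ge> 1\<close>.\<close>

record ('d, 'p) dp_admm =
  agents :: nat
  data :: "nat \<Rightarrow> ('d::finite, 'p::finite) dataset"
  loss :: "real ^ 'd \<Rightarrow> real ^ 'p \<Rightarrow> ('d, 'p) model \<Rightarrow> real"
  loss_sub :: "real ^ 'd \<Rightarrow> real ^ 'p \<Rightarrow> ('d, 'p) model \<Rightarrow> ('d, 'p) model"
  reg :: "('d, 'p) model \<Rightarrow> real"
  reg_sub :: "('d, 'p) model \<Rightarrow> ('d, 'p) model"
  reg_weight :: real
  penalty :: real
  step :: "nat \<Rightarrow> nat \<Rightarrow> real"
  init_global :: "('d, 'p) model"
  init_local :: "nat \<Rightarrow> ('d, 'p) model"
  init_dual :: "nat \<Rightarrow> ('d, 'p) model"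

definition is_subgradient :: "('a::real_inner \<Rightarrow> real) \<Rightarrow> 'a \<Rightarrow> 'a \<Rightarrow> bool" where
  "is_subgradient f g w \<longleftrightarrow> (\<forall>v. f v \<ge> f w + g \<bullet> (v - w))"

text \<open>The Borel measurability of the subgradient selections makes the outputs of the
  algorithm random variables.\<close>

definition dp_admm_setting :: "('d::finite, 'p::finite) dp_admm \<Rightarrow> bool" where
  "dp_admm_setting P \<longleftrightarrow>
     (\<forall>i\<in>{1..agents P}. data P i \<noteq> []) \<and>
     (\<forall>a b. convex_on UNIV (loss P a b)) \<and>
     (\<forall>a b w. is_subgradient (loss P a b) (loss_sub P a b w) w) \<and>
     (\<forall>a b. loss_sub P a b \<in> borel_measurable borel) \<and>
     convex_on UNIV (reg P) \<and>
     (\<forall>w. is_subgradient (reg P) (reg_sub P w) w) \<and>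
     reg_sub P \<in> borel_measurable borel \<and>
     reg_weight P > 0 \<and> penalty P > 0 \<and>
     (\<forall>i\<in>{1..agents P}. \<forall>k\<ge>1. step P i k > 0 \<and> step P i (Suc k) \<le> step P i k)"

definition local_obj ::
  "('d::finite, 'p::finite) dp_admm \<Rightarrow> ('d, 'p) dataset \<Rightarrow> ('d, 'p) model \<Rightarrow> real" where
  "local_obj P Di w =
     (\<Sum>j<length Di. 1 / real (length Di) * loss P (fst (Di ! j)) (snd (Di ! j)) w)
     + reg_weight P / real (agents P) * reg P w"

definition local_obj_sub ::
  "('d::finite, 'p::finite) dp_admm \<Rightarrow> ('d, 'p) dataset \<Rightarrow> ('d, 'p) model \<Rightarrow> ('d, 'p) model" where
  "local_obj_sub P Di w =
     (\<Sum>j<length Di. (1 / real (length Di)) *\<^sub>R loss_sub P (fst (Di ! j)) (snd (Di ! j)) w)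
     + (reg_weight P / real (agents P)) *\<^sub>R reg_sub P w"

definition approx_lagrangian ::
  "('d::finite, 'p::finite) dp_admm \<Rightarrow> nat \<Rightarrow> nat \<Rightarrow> ('d, 'p) model \<Rightarrow> ('d, 'p) model \<Rightarrow>
   ('d, 'p) model \<Rightarrow> ('d, 'p) model \<Rightarrow> real" where
  "approx_lagrangian P k i wi wt w \<gamma> =
     local_obj P (data P i) wt + local_obj_sub P (data P i) wt \<bullet> (wi - wt)
     - \<gamma> \<bullet> (wi - w) + penalty P / 2 * (norm (wi - w))\<^sup>2
     + (norm (wi - wt))\<^sup>2 / (2 * step P i k)"

text \<open>The triple after iteration \<open>k\<close> consists of the global model, the noisy local models and
  the dual variables, when the noise added by agent \<open>i\<close> in iteration \<open>k\<close> is \<open>\<xi> (i, k)\<close>.\<close>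

primrec dp_admm_state ::
  "('d::finite, 'p::finite) dp_admm \<Rightarrow> (nat \<times> nat \<Rightarrow> ('d, 'p) model) \<Rightarrow> nat \<Rightarrow>
   ('d, 'p) model \<times> (nat \<Rightarrow> ('d, 'p) model) \<times> (nat \<Rightarrow> ('d, 'p) model)" where
  "dp_admm_state P \<xi> 0 = (init_global P, init_local P, init_dual P)"
| "dp_admm_state P \<xi> (Suc k) =
     (let (w, wt, \<gamma>) = dp_admm_state P \<xi> k;
          wt' = (\<lambda>i. arg_min (\<lambda>wi. approx_lagrangian P (Suc k) i wi (wt i) w (\<gamma> i)) (\<lambda>_. True)
                     + \<xi> (i, Suc k));
          w' = (1 / real (agents P)) *\<^sub>R (\<Sum>i=1..agents P. wt' i)
               - (1 / real (agents P)) *\<^sub>R (\<Sum>i=1..agents P. (1 / penalty P) *\<^sub>R \<gamma> i);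
          \<gamma>' = (\<lambda>i. \<gamma> i - penalty P *\<^sub>R (wt' i - w'))
      in (w', wt', \<gamma>'))"

definition noisy_local ::
  "('d::finite, 'p::finite) dp_admm \<Rightarrow> (nat \<times> nat \<Rightarrow> ('d, 'p) model) \<Rightarrow> nat \<Rightarrow> nat \<Rightarrow> ('d, 'p) model"
  where "noisy_local P \<xi> i k = fst (snd (dp_admm_state P \<xi> k)) i"

text \<open>The library's \<open>normal_density\<close> is identically zero for standard deviation \<open>0\<close>, where the
  normal distribution is the point mass at its mean.\<close>

definition gaussian :: "real \<Rightarrow> real measure" where
  "gaussian \<sigma> = (if \<sigma> = 0 then return borel 0 else density lborel (\<lambda>x. ennreal (normal_density 0 \<sigma> x)))"

definition gaussian_matrix :: "real \<Rightarrow> ('d::finite, 'p::finite) model measure" where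
  "gaussian_matrix \<sigma> =
     distr (\<Pi>\<^sub>M e\<in>(UNIV :: ('d \<times> 'p) set). gaussian \<sigma>) borel (\<lambda>x. \<chi> r c. x (r, c))"

definition noise_space ::
  "nat \<Rightarrow> (nat \<Rightarrow> nat \<Rightarrow> real) \<Rightarrow> nat \<Rightarrow> (nat \<times> nat \<Rightarrow> ('d::finite, 'p::finite) model) measure" where
  "noise_space n \<sigma> t = (\<Pi>\<^sub>M (i, k)\<in>{1..n} \<times> {1..t}. gaussian_matrix (\<sigma> i k))"

text \<open>The law of the outputs of agent \<open>i\<close> in iterations \<open>1, \<dots>, t\<close>, as a function of the dataset
  of agent \<open>i\<close>; the datasets of the other agents are those of \<open>P\<close>.\<close>

definition dp_admm_mechanism ::
  "('d::finite, 'p::finite) dp_admm \<Rightarrow> (nat \<Rightarrow> nat \<Rightarrow> real) \<Rightarrow> nat \<Rightarrow> nat \<Rightarrow> ('d, 'p) dataset \<Rightarrow>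
   (nat \<Rightarrow> ('d, 'p) model) measure" where
  "dp_admm_mechanism P \<sigma> t i Di =
     distr (noise_space (agents P) \<sigma> t) (\<Pi>\<^sub>M k\<in>{1..t}. borel)
       (\<lambda>\<xi>. \<lambda>k\<in>{1..t}. noisy_local (P\<lparr>data := (data P)(i := Di)\<rparr>) \<xi> i k)"

definition neighbouring :: "'x list \<Rightarrow> 'x list \<Rightarrow> bool" where
  "neighbouring D D' \<longleftrightarrow> (\<exists>j<length D. \<exists>z. D' = D[j := z])"

definition differentially_private ::
  "'x list set \<Rightarrow> ('x list \<Rightarrow> 'y measure) \<Rightarrow> real \<Rightarrow> real \<Rightarrow> bool" where
  "differentially_private X M \<epsilon> \<delta> \<longleftrightarrow>
     (\<forall>D\<in>X. \<forall>D'\<in>X. neighbouring D D' \<longrightarrow>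
       (\<forall>S\<in>sets (M D). measure (M D) S \<le> exp \<epsilon> * measure (M D') S + \<delta>))"

definition dp_admm_private ::
  "('d::finite, 'p::finite) dp_admm \<Rightarrow> (nat \<Rightarrow> nat \<Rightarrow> real) \<Rightarrow> nat \<Rightarrow> real \<Rightarrow> real \<Rightarrow> bool" where
  "dp_admm_private P \<sigma> t \<epsilon> \<delta> \<longleftrightarrow>
     (\<forall>i\<in>{1..agents P}.
        differentially_private {Di. length Di = length (data P i)} (dp_admm_mechanism P \<sigma> t i) \<epsilon> \<delta>)"

definition noise_level ::
  "('d::finite, 'p::finite) dp_admm \<Rightarrow> real \<Rightarrow> real \<Rightarrow> real \<Rightarrow> nat \<Rightarrow> nat \<Rightarrow> real" where
  "noise_level P c1 \<epsilon> \<delta> i k =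
     2 * c1 * sqrt (2 * ln (1.25 / \<delta>))
     / (real (length (data P i)) * \<epsilon> * (penalty P + 1 / step P i k))"

end

theory Submission imports Defs begin

text \<open>Fix an agent, replace its dataset \<open>D\<close> by a neighbour \<open>D'\<close>, and do so one iteration at a time.
  Since the local update is an explicit affine function of the subgradient, using \<open>D\<close> instead of
  \<open>D'\<close> in iteration \<open>k\<close> has the same effect as shifting the noise of that iteration by a vector
  that depends on earlier noise only and has norm at most \<open>\<mu> \<sigma>\<^sub>k\<close>, where
  \<open>\<mu> = \<epsilon> / sqrt (2 L)\<close> and \<open>L = ln (1.25 / \<delta>)\<close>. Hence the law under \<open>D\<close> is obtained from the law under
  \<open>D'\<close> by weighting with a product \<open>\<Lambda>\<close> of \<open>t\<close> Gaussian likelihood ratios, whose moment of order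
  \<open>s + 1\<close> is at most \<open>exp (s (s + 1) t \<mu>\<^sup>2 / 2)\<close>. As \<open>\<Lambda> \<le> exp E + exp (- s E) \<Lambda>\<^bsup>s + 1\<^esup>\<close>, this
  gives \<open>(E, \<delta>)\<close>-privacy for \<open>E \<ge> t \<epsilon>\<^sup>2 / (4 L) + sqrt t \<epsilon>\<close>.\<close>

section \<open>Gaussian shifts\<close>

text \<open>For \<open>\<sigma> \<noteq> 0\<close>, the density at \<open>y\<close> of the isotropic
  Gaussian with mean \<open>v\<close> relative to the centred one.\<close>

definition gauss_ratio :: "real \<Rightarrow> 'a::real_inner \<Rightarrow> 'a \<Rightarrow> real" where
  "gauss_ratio \<sigma> v y = exp ((v \<bullet> y) / \<sigma>\<^sup>2 - (norm v)\<^sup>2 / (2 * \<sigma>\<^sup>2))"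

text \<open>For \<open>\<sigma> = 0\<close> only \<open>v = 0\<close> is admitted. There \<open>gauss_ratio\<close> is \<open>1\<close>, since division by zero gives
  zero, so the point mass is covered as well.\<close>

definition gaussian_shift :: "'a::euclidean_space measure \<Rightarrow> real \<Rightarrow> bool" where
  "gaussian_shift M \<sigma> \<longleftrightarrow> sets M = sets borel \<and>
     (\<forall>v. \<forall>f\<in>borel_measurable borel. (\<sigma> = 0 \<longrightarrow> v = 0) \<longrightarrow>
        (\<integral>\<^sup>+y. f (y + v) \<partial>M) = (\<integral>\<^sup>+y. f y * ennreal (gauss_ratio \<sigma> v y) \<partial>M))"

lemma gaussian_shiftD:
  assumes "gaussian_shift M \<sigma>" "f \<in> borel_measurable borel" "\<sigma> = 0 \<Longrightarrow> v = 0"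
  shows "(\<integral>\<^sup>+y. f (y + v) \<partial>M) = (\<integral>\<^sup>+y. f y * ennreal (gauss_ratio \<sigma> v y) \<partial>M)"
  using assms unfolding gaussian_shift_def by blast

lemma gauss_ratio_0 [simp]: "gauss_ratio \<sigma> 0 y = 1"
  by (simp add: gauss_ratio_def)

lemma gauss_ratio_pos: "0 < gauss_ratio \<sigma> v y"
  by (simp add: gauss_ratio_def)

lemma borel_measurable_gauss_ratio [measurable (raw)]:
  fixes v y :: "'b \<Rightarrow> 'a::euclidean_space"
  assumes "v \<in> borel_measurable N" "y \<in> borel_measurable N"
  shows "(\<lambda>x. gauss_ratio \<sigma> (v x) (y x)) \<in> borel_measurable N"
  using assms unfolding gauss_ratio_def by measurable

text \<open>Fubini with coordinate \<open>j\<close> innermost: by \<open>indep\<close> the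
  displacement is constant there, so the identity for a single Gaussian applies although
  \<open>h\<close> may vary with all other coordinates.\<close>

lemma nn_integral_coordinate_shift:
  fixes M :: "'i \<Rightarrow> 'a::euclidean_space measure"
  assumes "product_sigma_finite M" and I: "finite I" "j \<in> I"
    and sets: "\<And>i. i \<in> I \<Longrightarrow> sets (M i) = sets borel"
    and shift: "gaussian_shift (M j) \<sigma>"
    and h: "h \<in> borel_measurable (Pi\<^sub>M I M)"
    and indep: "\<And>x y. h (x(j := y)) = h x"
    and null: "\<And>x. \<sigma> = 0 \<Longrightarrow> h x = 0"
    and F: "F \<in> borel_measurable (Pi\<^sub>M I M)"
  shows "(\<integral>\<^sup>+x. F (x(j := x j + h x)) \<partial>Pi\<^sub>M I M)
       = (\<integral>\<^sup>+x. F x * ennreal (gauss_ratio \<sigma> (h x) (x j)) \<partial>Pi\<^sub>M I M)"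
proof -
  interpret product_sigma_finite M by fact
  define J where "J = I - {j}"
  have J: "finite J" "j \<notin> J" "I = insert j J" using I by (auto simp: J_def)
  have Mj: "sets (M j) = sets borel" using I sets by auto
  have comp [measurable]: "(\<lambda>x. x j) \<in> borel_measurable (Pi\<^sub>M I M)"
    using measurable_component_singleton[OF I(2), of M] measurable_cong_sets[OF refl Mj] by blast
  have upd: "(\<lambda>x. x(j := x j + h x)) \<in> measurable (Pi\<^sub>M I M) (Pi\<^sub>M I M)"
  proof -
    have "(\<lambda>x. \<lambda>i\<in>I. if i = j then x j + h x else x i) \<in> measurable (Pi\<^sub>M I M) (Pi\<^sub>M I M)"
    proof (rule measurable_restrict)
      fix i assume "i \<in> I"
      then show "(\<lambda>x. if i = j then x j + h x else x i) \<in> measurable (Pi\<^sub>M I M) (M i)"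
        using h comp by (cases "i = j") (simp_all add: measurable_cong_sets[OF refl Mj])
    qed
    moreover have "(\<lambda>i\<in>I. if i = j then x j + h x else x i) = x(j := x j + h x)"
      if "x \<in> space (Pi\<^sub>M I M)" for x
      using that I by (auto simp: space_PiM PiE_def extensional_def)
    ultimately show ?thesis
      by (subst measurable_cong[where g = "\<lambda>x. \<lambda>i\<in>I. if i = j then x j + h x else x i"]) auto
  qed
  have ins: "integral\<^sup>N (Pi\<^sub>M I M) G = (\<integral>\<^sup>+x. (\<integral>\<^sup>+y. G (x(j := y)) \<partial>M j) \<partial>Pi\<^sub>M J M)"
    if "G \<in> borel_measurable (Pi\<^sub>M I M)" for G
    using product_nn_integral_insert[OF J(1,2)] that J(3) by simp
  have "(\<integral>\<^sup>+x. F (x(j := x j + h x)) \<partial>Pi\<^sub>M I M)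
      = (\<integral>\<^sup>+x. (\<integral>\<^sup>+y. F (x(j := y + h x)) \<partial>M j) \<partial>Pi\<^sub>M J M)"
    by (subst ins) (use measurable_compose[OF upd F] in \<open>simp_all add: indep\<close>)
  also have "\<dots> = (\<integral>\<^sup>+x. (\<integral>\<^sup>+y. F (x(j := y)) * ennreal (gauss_ratio \<sigma> (h x) y) \<partial>M j) \<partial>Pi\<^sub>M J M)"
  proof (rule nn_integral_cong)
    fix x assume "x \<in> space (Pi\<^sub>M J M)"
    then have "(\<lambda>y. x(j := y)) \<in> measurable (M j) (Pi\<^sub>M I M)"
      using measurable_component_update J by metis
    then have "(\<lambda>y. F (x(j := y))) \<in> borel_measurable (M j)"
      using F by (rule measurable_compose)
    then have "(\<lambda>y. F (x(j := y))) \<in> borel_measurable borel"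
      by (simp add: measurable_cong_sets[OF Mj refl])
    then show "(\<integral>\<^sup>+y. F (x(j := y + h x)) \<partial>M j)
        = (\<integral>\<^sup>+y. F (x(j := y)) * ennreal (gauss_ratio \<sigma> (h x) y) \<partial>M j)"
      using null by (rule gaussian_shiftD[OF shift])
  qed
  also have "\<dots> = (\<integral>\<^sup>+x. F x * ennreal (gauss_ratio \<sigma> (h x) (x j)) \<partial>Pi\<^sub>M I M)"
    by (subst ins) (use F h comp in \<open>simp_all add: indep\<close>)
  finally show ?thesis .
qed

section \<open>Gaussian laws on the reals and on matrices\<close>

text \<open>Translation invariance of \<open>lborel\<close> moves the shift onto the density, and
  the quotient of the two densities is the ratio.\<close>

lemma gaussian_shift_gaussian: "gaussian_shift (gaussian \<sigma>) \<sigma>"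
  unfolding gaussian_shift_def
proof (intro conjI allI ballI impI)
  show "sets (gaussian \<sigma>) = sets borel" by (simp add: gaussian_def)
next
  fix v :: real and f :: "real \<Rightarrow> ennreal"
  assume f [measurable]: "f \<in> borel_measurable borel" and v: "\<sigma> = 0 \<longrightarrow> v = 0"
  show "(\<integral>\<^sup>+y. f (y + v) \<partial>gaussian \<sigma>) = (\<integral>\<^sup>+y. f y * ennreal (gauss_ratio \<sigma> v y) \<partial>gaussian \<sigma>)"
  proof (cases "\<sigma> = 0")
    case True
    with v show ?thesis by simp
  next
    case False
    have "(\<integral>\<^sup>+y. f (y + v) \<partial>gaussian \<sigma>) = (\<integral>\<^sup>+y. ennreal (normal_density 0 \<sigma> y) * f (y + v) \<partial>lborel)"
      using False by (simp add: gaussian_def nn_integral_density)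
    also have "\<dots> = (\<integral>\<^sup>+y. ennreal (normal_density 0 \<sigma> (y - v)) * f y \<partial>lborel)"
      by (subst nn_integral_real_affine[of _ 1 "-v"]) (auto simp: add.commute)
    also have "\<dots> = (\<integral>\<^sup>+y. ennreal (normal_density 0 \<sigma> y) * (f y * ennreal (gauss_ratio \<sigma> v y)) \<partial>lborel)"
    proof (rule nn_integral_cong)
      fix y
      have "normal_density 0 \<sigma> (y - v) = normal_density 0 \<sigma> y * gauss_ratio \<sigma> v y"
        using False by (simp add: normal_density_def gauss_ratio_def flip: exp_add)
          (simp add: field_simps power2_eq_square)
      then show "ennreal (normal_density 0 \<sigma> (y - v)) * f y
          = ennreal (normal_density 0 \<sigma> y) * (f y * ennreal (gauss_ratio \<sigma> v y))"
        by (simp add: ennreal_mult gauss_ratio_pos less_imp_le ac_simps)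
    qed
    also have "\<dots> = (\<integral>\<^sup>+y. f y * ennreal (gauss_ratio \<sigma> v y) \<partial>gaussian \<sigma>)"
      using False by (simp add: gaussian_def nn_integral_density)
    finally show ?thesis .
  qed
qed

lemma prob_space_gaussian: "prob_space (gaussian \<sigma>)"
proof (cases "\<sigma> = 0")
  case True
  then show ?thesis by (simp add: gaussian_def prob_space_return)
next
  case False
  \<comment> \<open>Only the square of \<open>\<sigma>\<close> enters the density, so a negative
    \<open>\<sigma>\<close> may be replaced by its absolute value.\<close>
  have "normal_density 0 \<sigma> = normal_density 0 \<bar>\<sigma>\<bar>"
    by (simp add: normal_density_def fun_eq_iff)
  then show ?thesis
    using False prob_space_normal_density[of "\<bar>\<sigma>\<bar>" 0] by (simp add: gaussian_def)
qed

lemma sets_gaussian [simp, measurable_cong]: "sets (gaussian \<sigma>) = sets borel"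
  by (simp add: gaussian_def)

lemma measurable_vec_of_pairs [measurable]:
  "(\<lambda>x. \<chi> r c. x (r, c)) \<in> borel_measurable (\<Pi>\<^sub>M e\<in>(UNIV :: ('d::finite \<times> 'p::finite) set). gaussian \<sigma>)"
  by (subst borel_measurable_euclidean_space) (auto simp: Basis_vec_def inner_axis)

text \<open>\<open>E\<close> collects the coordinates already shifted. Each new one is a coordinate
  shift with constant displacement.\<close>

lemma nn_integral_gaussian_vector_shift:
  fixes v :: "'e::finite \<Rightarrow> real"
  assumes "finite E" "\<sigma> = 0 \<Longrightarrow> v = (\<lambda>_. 0)"
    and "f \<in> borel_measurable (\<Pi>\<^sub>M e\<in>(UNIV :: 'e set). gaussian \<sigma>)"
  shows "(\<integral>\<^sup>+x. f (\<lambda>e. x e + (if e \<in> E then v e else 0)) \<partial>(\<Pi>\<^sub>M e\<in>(UNIV :: 'e set). gaussian \<sigma>))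
       = (\<integral>\<^sup>+x. f x * ennreal (\<Prod>e\<in>E. gauss_ratio \<sigma> (v e) (x e)) \<partial>(\<Pi>\<^sub>M e\<in>(UNIV :: 'e set). gaussian \<sigma>))"
  using assms
proof (induction E arbitrary: f rule: finite_induct)
  case empty
  then show ?case by simp
next
  case (insert a E)
  let ?N = "\<Pi>\<^sub>M e\<in>(UNIV :: 'e set). gaussian \<sigma>"
  let ?W = "\<lambda>x. ennreal (\<Prod>e\<in>E. gauss_ratio \<sigma> (v e) (x e))"
  have sf: "product_sigma_finite (\<lambda>_::'e. gaussian \<sigma>)"
    by (simp add: product_sigma_finite_def prob_space_gaussian prob_space_imp_sigma_finite)
  have W [measurable]: "?W \<in> borel_measurable ?N" by measurable
  note f [measurable] = insert.prems(2)
  have upd: "(\<lambda>x. x(a := x a + v a)) \<in> measurable ?N ?N"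
    by (rule measurable_fun_upd[where J = UNIV]) auto
  have "(\<integral>\<^sup>+x. f (\<lambda>e. x e + (if e \<in> insert a E then v e else 0)) \<partial>?N)
      = (\<integral>\<^sup>+x. (\<lambda>x. f (x(a := x a + v a))) (\<lambda>e. x e + (if e \<in> E then v e else 0)) \<partial>?N)"
    using insert.hyps by (intro nn_integral_cong arg_cong[where f = f]) auto
  also have "\<dots> = (\<integral>\<^sup>+x. f (x(a := x a + v a)) * ?W x \<partial>?N)"
    by (rule insert.IH[OF insert.prems(1) measurable_compose[OF upd f]])
  \<comment> \<open>As \<open>a\<close> is not in \<open>E\<close>, the weight \<open>?W\<close>
    does not see the update at \<open>a\<close> and may be moved under it.\<close>
  also have "\<dots> = (\<integral>\<^sup>+x. (\<lambda>x. f x * ?W x) (x(a := x a + v a)) \<partial>?N)"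
    using insert.hyps by (intro nn_integral_cong) (auto intro!: arg_cong[where f = "\<lambda>z. _ * ennreal z"] prod.cong)
  also have "\<dots> = (\<integral>\<^sup>+x. (f x * ?W x) * ennreal (gauss_ratio \<sigma> (v a) (x a)) \<partial>?N)"
    by (rule nn_integral_coordinate_shift[OF sf])
      (use insert.prems(1) in \<open>auto simp: gaussian_shift_gaussian\<close>)
  also have "\<dots> = (\<integral>\<^sup>+x. f x * ennreal (\<Prod>e\<in>insert a E. gauss_ratio \<sigma> (v e) (x e)) \<partial>?N)"
    using insert.hyps
    by (intro nn_integral_cong)
      (simp add: ennreal_mult gauss_ratio_pos less_imp_le prod_nonneg ac_simps)
  finally show ?case .
qed

text \<open>The exponents add up, since the Frobenius inner product and squared norm are sums over
  the entries.\<close>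

lemma prod_gauss_ratio_matrix:
  fixes v y :: "('d::finite, 'p::finite) model"
  shows "(\<Prod>e\<in>UNIV. gauss_ratio \<sigma> (v $ fst e $ snd e) (y $ fst e $ snd e)) = gauss_ratio \<sigma> v y"
proof -
  have pairs: "(\<Sum>e\<in>UNIV. f (fst e) (snd e)) = (\<Sum>r\<in>UNIV. \<Sum>c\<in>UNIV. f r c)"
    for f :: "'d \<Rightarrow> 'p \<Rightarrow> real"
    by (simp add: sum.cartesian_product case_prod_beta)
  have "v \<bullet> y = (\<Sum>e\<in>UNIV. v $ fst e $ snd e * y $ fst e $ snd e)"
    by (subst pairs) (simp add: inner_vec_def)
  moreover have "(norm v)\<^sup>2 = (\<Sum>e\<in>UNIV. (v $ fst e $ snd e)\<^sup>2)"
    unfolding power2_norm_eq_inner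
    by (subst pairs) (simp add: inner_vec_def power2_eq_square)
  ultimately show ?thesis
    by (simp add: gauss_ratio_def sum_subtractf sum_divide_distrib flip: exp_sum)
qed

lemma gaussian_shift_gaussian_matrix:
  "gaussian_shift (gaussian_matrix \<sigma> :: ('d::finite, 'p::finite) model measure) \<sigma>"
  unfolding gaussian_shift_def
proof (intro conjI allI ballI impI)
  show "sets (gaussian_matrix \<sigma> :: ('d, 'p) model measure) = sets borel"
    by (simp add: gaussian_matrix_def)
next
  fix v :: "('d, 'p) model" and f :: "('d, 'p) model \<Rightarrow> ennreal"
  assume f [measurable]: "f \<in> borel_measurable borel" and v: "\<sigma> = 0 \<longrightarrow> v = 0"
  let ?N = "\<Pi>\<^sub>M e\<in>(UNIV :: ('d \<times> 'p) set). gaussian \<sigma>"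
  let ?mat = "\<lambda>x. \<chi> r c. x (r, c)"
  let ?v = "\<lambda>e. v $ fst e $ snd e"
  have "(\<integral>\<^sup>+y. f (y + v) \<partial>gaussian_matrix \<sigma>) = (\<integral>\<^sup>+x. f (?mat x + v) \<partial>?N)"
    unfolding gaussian_matrix_def by (subst nn_integral_distr) auto
  also have "\<dots> = (\<integral>\<^sup>+x. (\<lambda>x. f (?mat x)) (\<lambda>e. x e + (if e \<in> UNIV then ?v e else 0)) \<partial>?N)"
    by (intro nn_integral_cong arg_cong[where f = f]) (simp add: vec_eq_iff)
  also have "\<dots> = (\<integral>\<^sup>+x. f (?mat x) * ennreal (\<Prod>e\<in>UNIV. gauss_ratio \<sigma> (?v e) (x e)) \<partial>?N)"
    by (rule nn_integral_gaussian_vector_shift) (use v in auto)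
  also have "\<dots> = (\<integral>\<^sup>+x. f (?mat x) * ennreal (gauss_ratio \<sigma> v (?mat x)) \<partial>?N)"
    by (simp flip: prod_gauss_ratio_matrix)
  also have "\<dots> = (\<integral>\<^sup>+y. f y * ennreal (gauss_ratio \<sigma> v y) \<partial>gaussian_matrix \<sigma>)"
    unfolding gaussian_matrix_def by (subst nn_integral_distr) auto
  finally show "(\<integral>\<^sup>+y. f (y + v) \<partial>gaussian_matrix \<sigma>)
      = (\<integral>\<^sup>+y. f y * ennreal (gauss_ratio \<sigma> v y) \<partial>gaussian_matrix \<sigma>)" .
qed

lemma prob_space_gaussian_matrix: "prob_space (gaussian_matrix \<sigma>)"
  unfolding gaussian_matrix_def
  by (intro prob_space.prob_space_distr prob_space_PiM prob_space_gaussian) measurable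

section \<open>Adaptively shifted Gaussian noise\<close>

text \<open>The coordinates \<open>c 0, c 1, \<dots>\<close> hold the noise of the successive rounds. \<open>h k\<close> is the
  displacement of the mean in round \<open>k\<close>, which may depend on the noise of earlier rounds.\<close>

locale adaptive_gaussian =
  fixes M :: "'i \<Rightarrow> 'a::euclidean_space measure" and I :: "'i set"
    and c :: "nat \<Rightarrow> 'i" and \<sigma> :: "nat \<Rightarrow> real" and h :: "nat \<Rightarrow> ('i \<Rightarrow> 'a) \<Rightarrow> 'a"
    and t :: nat and \<mu> :: real
  assumes prob: "\<And>i. prob_space (M i)"
    and finite: "finite I"
    and sets: "\<And>i. i \<in> I \<Longrightarrow> sets (M i) = sets borel"
    and coord: "\<And>k. k < t \<Longrightarrow> c k \<in> I"
    and distinct: "\<And>k l. k < l \<Longrightarrow> l < t \<Longrightarrow> c k \<noteq> c l"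
    and shift: "\<And>k. k < t \<Longrightarrow> gaussian_shift (M (c k)) (\<sigma> k)"
    and meas: "\<And>k. k < t \<Longrightarrow> h k \<in> borel_measurable (Pi\<^sub>M I M)"
    and adapted: "\<And>k l x y. k \<le> l \<Longrightarrow> l < t \<Longrightarrow> h k (x(c l := y)) = h k x"
    and bound: "\<And>k x. k < t \<Longrightarrow> norm (h k x) \<le> \<mu> * \<bar>\<sigma> k\<bar>"
begin

sublocale product_prob_space M I
  by (simp add: product_prob_space_def product_prob_space_axioms_def product_sigma_finite_def
      prob prob_space_imp_sigma_finite)

text \<open>The likelihood ratio of the first \<open>K\<close> rounds when all displacements are
  scaled by \<open>a\<close>. The case \<open>a = 1\<close> is the true ratio;
  \<open>a = s + 1\<close> serves to control its moment of order \<open>s + 1\<close>.\<close>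

definition likelihood :: "real \<Rightarrow> nat \<Rightarrow> ('i \<Rightarrow> 'a) \<Rightarrow> real" where
  "likelihood a K x = (\<Prod>k<K. gauss_ratio (\<sigma> k) (a *\<^sub>R h k x) (x (c k)))"

lemma likelihood_nonneg: "0 \<le> likelihood a K x"
  by (simp add: likelihood_def prod_nonneg gauss_ratio_pos less_imp_le)

text \<open>Rounds before \<open>K\<close> do not read the noise of round \<open>l\<close>: neither
  in their displacements (\<open>adapted\<close>) nor in their own coordinates
  (\<open>distinct\<close>).\<close>

lemma likelihood_upd:
  "K \<le> l \<Longrightarrow> l < t \<Longrightarrow> likelihood a K (x(c l := y)) = likelihood a K x"
  unfolding likelihood_def by (rule prod.cong) (auto simp: adapted distinct)

lemma measurable_coord: "k < t \<Longrightarrow> (\<lambda>x. x (c k)) \<in> borel_measurable (Pi\<^sub>M I M)"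
  using measurable_component_singleton[OF coord, of k M] measurable_cong_sets[OF refl sets[OF coord]]
  by blast

lemma measurable_likelihood [measurable]:
  "K \<le> t \<Longrightarrow> likelihood a K \<in> borel_measurable (Pi\<^sub>M I M)"
  unfolding likelihood_def[abs_def]
  by (intro borel_measurable_prod borel_measurable_gauss_ratio borel_measurable_scaleR
      borel_measurable_const meas measurable_coord) auto

text \<open>Change of measure in one round: the ratio of the earlier rounds passes under the shift
  unchanged, and the shift contributes the factor of round \<open>K\<close>.\<close>

lemma nn_integral_likelihood_Suc:
  assumes K: "K < t" and F: "F \<in> borel_measurable (Pi\<^sub>M I M)"
  shows "(\<integral>\<^sup>+x. F (x(c K := x (c K) + a *\<^sub>R h K x)) * ennreal (likelihood a K x) \<partial>Pi\<^sub>M I M)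
       = (\<integral>\<^sup>+x. F x * ennreal (likelihood a (Suc K) x) \<partial>Pi\<^sub>M I M)"
proof -
  \<comment> \<open>For \<open>\<sigma> K = 0\<close> the norm bound forces the zero displacement,
    the only one that \<open>gaussian_shift\<close> admits there.\<close>
  have null: "h K x = 0" if "\<sigma> K = 0" for x
    using bound[OF K, of x] that by simp
  have "(\<integral>\<^sup>+x. F (x(c K := x (c K) + a *\<^sub>R h K x)) * ennreal (likelihood a K x) \<partial>Pi\<^sub>M I M)
      = (\<integral>\<^sup>+x. (\<lambda>x. F x * ennreal (likelihood a K x)) (x(c K := x (c K) + a *\<^sub>R h K x)) \<partial>Pi\<^sub>M I M)"
    using K by (simp add: likelihood_upd)
  also have "\<dots> = (\<integral>\<^sup>+x. (F x * ennreal (likelihood a K x))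
      * ennreal (gauss_ratio (\<sigma> K) (a *\<^sub>R h K x) (x (c K))) \<partial>Pi\<^sub>M I M)"
    using K F meas[OF K]
    by (intro nn_integral_coordinate_shift product_sigma_finite_axioms finite coord sets shift
        borel_measurable_times_ennreal measurable_compose[OF _ measurable_ennreal])
      (auto simp: adapted null)
  also have "\<dots> = (\<integral>\<^sup>+x. F x * ennreal (likelihood a (Suc K) x) \<partial>Pi\<^sub>M I M)"
    by (intro nn_integral_cong)
      (simp add: likelihood_def ennreal_mult prod_nonneg gauss_ratio_pos less_imp_le ac_simps)
  finally show ?thesis .
qed

text \<open>A constant integrand does not notice the shift, so every round preserves the total mass,
  whatever the scaling \<open>a\<close>.\<close>

lemma nn_integral_likelihood: "K \<le> t \<Longrightarrow> (\<integral>\<^sup>+x. ennreal (likelihood a K x) \<partial>Pi\<^sub>M I M) = 1"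
proof (induction K)
  case 0
  then show ?case by (simp add: likelihood_def emeasure_space_1)
next
  case (Suc K)
  then show ?case
    using nn_integral_likelihood_Suc[of K "\<lambda>_. 1" a] by simp
qed

text \<open>\<open>step\<close> trades \<open>G K\<close> for \<open>G (Suc K)\<close> under
  displaced noise, and the change of measure turns the displacement into one more factor.\<close>

lemma nn_integral_hybrid:
  assumes G: "\<And>k. k \<le> t \<Longrightarrow> G k \<in> borel_measurable (Pi\<^sub>M I M)"
    and step: "\<And>k x. k < t \<Longrightarrow> G k x = G (Suc k) (x(c k := x (c k) + h k x))"
  shows "K \<le> t \<Longrightarrow> (\<integral>\<^sup>+x. G 0 x \<partial>Pi\<^sub>M I M) = (\<integral>\<^sup>+x. G K x * ennreal (likelihood 1 K x) \<partial>Pi\<^sub>M I M)"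
proof (induction K)
  case 0
  then show ?case by (simp add: likelihood_def)
next
  case (Suc K)
  then show ?case
    using nn_integral_likelihood_Suc[of K "G (Suc K)" 1] G[of "Suc K"] by (simp add: step)
qed

text \<open>Where the ratio exceeds \<open>exp E\<close>, it is at most \<open>exp (- s * E)\<close>
  times its power of order \<open>s + 1\<close>. That power is bounded pointwise by a multiple of
  \<open>likelihood (s + 1) t x\<close>, whose integral is 1.\<close>

lemma likelihood_tail:
  assumes s: "0 \<le> s"
  shows "likelihood 1 t x \<le> exp E + exp (s * (s + 1) * (real t * \<mu>\<^sup>2 / 2) - s * E) * likelihood (s + 1) t x"
proof -
  define p where "p k = (h k x \<bullet> x (c k)) / (\<sigma> k)\<^sup>2" for k
  define q where "q k = (norm (h k x))\<^sup>2 / (2 * (\<sigma> k)\<^sup>2)" for k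
  have lik: "likelihood a t x = exp (a * (\<Sum>k<t. p k) - a\<^sup>2 * (\<Sum>k<t. q k))" for a
    unfolding sum_distrib_left sum_subtractf[symmetric] exp_sum[OF finite_lessThan] likelihood_def
    by (rule prod.cong) (auto simp: gauss_ratio_def p_def q_def power_mult_distrib)
  \<comment> \<open>For \<open>\<sigma> k = 0\<close> division by zero gives
    \<open>q k = 0\<close>.\<close>
  have "q k \<le> \<mu>\<^sup>2 / 2" if "k < t" for k
  proof (cases "\<sigma> k = 0")
    case False
    have "(norm (h k x))\<^sup>2 \<le> (\<mu> * \<bar>\<sigma> k\<bar>)\<^sup>2"
      using bound[OF that] by (rule power_mono) simp
    then show ?thesis
      using False by (simp add: q_def field_simps power_mult_distrib)
  qed (simp add: q_def)
  then have "(\<Sum>k<t. q k) \<le> real t * (\<mu>\<^sup>2 / 2)"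
    using sum_bounded_above[of "{..<t}" q "\<mu>\<^sup>2 / 2"] by simp
  then have Q: "s * (s + 1) * (\<Sum>k<t. q k) \<le> s * (s + 1) * (real t * \<mu>\<^sup>2 / 2)"
    using s by (intro mult_left_mono) auto
  \<comment> \<open>\<open>u\<close> is the logarithm of \<open>likelihood 1 t x\<close>.\<close>
  define u where "u = (\<Sum>k<t. p k) - (\<Sum>k<t. q k)"
  have "exp u \<le> exp E + exp ((s + 1) * u - s * E)"
  proof (cases "u \<le> E")
    case True
    then show ?thesis by (simp add: add_increasing2)
  next
    case False
    then have "0 \<le> s * (u - E)" using s by simp
    then show ?thesis by (simp add: add_increasing algebra_simps)
  qed
  \<comment> \<open>Replacing \<open>(s + 1) * u\<close> by the exponent of
    \<open>likelihood (s + 1) t x\<close> costs exactly \<open>s * (s + 1)\<close> times the sum of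
    the \<open>q k\<close>, which \<open>Q\<close> bounds.\<close>
  also have "(s + 1) * u - s * E \<le> (s * (s + 1) * (real t * \<mu>\<^sup>2 / 2) - s * E)
      + ((s + 1) * (\<Sum>k<t. p k) - (s + 1)\<^sup>2 * (\<Sum>k<t. q k))"
    using Q by (simp add: u_def algebra_simps power2_eq_square)
  finally show ?thesis
    by (simp add: lik u_def flip: exp_add)
qed

text \<open>The tail bound is integrated against \<open>G t\<close>. In its second summand
  \<open>G t\<close> is replaced by 1, which leaves a likelihood of total mass 1.\<close>

lemma nn_integral_hybrid_le:
  assumes G: "\<And>k. k \<le> t \<Longrightarrow> G k \<in> borel_measurable (Pi\<^sub>M I M)"
    and step: "\<And>k x. k < t \<Longrightarrow> G k x = G (Suc k) (x(c k := x (c k) + h k x))"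
    and le_1: "\<And>x. G t x \<le> 1" and s: "0 \<le> s"
  shows "(\<integral>\<^sup>+x. G 0 x \<partial>Pi\<^sub>M I M) \<le> ennreal (exp E) * (\<integral>\<^sup>+x. G t x \<partial>Pi\<^sub>M I M)
       + ennreal (exp (s * (s + 1) * (real t * \<mu>\<^sup>2 / 2) - s * E))"
proof -
  let ?C = "exp (s * (s + 1) * (real t * \<mu>\<^sup>2 / 2) - s * E)"
  note G_t [measurable] = G[OF order_refl]
  have "(\<integral>\<^sup>+x. G 0 x \<partial>Pi\<^sub>M I M) = (\<integral>\<^sup>+x. G t x * ennreal (likelihood 1 t x) \<partial>Pi\<^sub>M I M)"
    using G step by (rule nn_integral_hybrid) simp_all
  also have "\<dots> \<le> (\<integral>\<^sup>+x. ennreal (exp E) * G t x + ennreal ?C * ennreal (likelihood (s + 1) t x) \<partial>Pi\<^sub>M I M)"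
  proof (rule nn_integral_mono)
    fix x
    have "G t x * ennreal (likelihood 1 t x)
        \<le> G t x * (ennreal (exp E) + ennreal ?C * ennreal (likelihood (s + 1) t x))"
      using likelihood_tail[OF s, of x E]
      by (intro mult_left_mono)
        (simp_all add: likelihood_nonneg flip: ennreal_mult ennreal_plus)
    also have "\<dots> \<le> ennreal (exp E) * G t x + 1 * (ennreal ?C * ennreal (likelihood (s + 1) t x))"
      unfolding distrib_left
      by (intro add_mono mult_right_mono le_1) (simp_all add: mult.commute)
    finally show "G t x * ennreal (likelihood 1 t x)
        \<le> ennreal (exp E) * G t x + ennreal ?C * ennreal (likelihood (s + 1) t x)" by simp
  qed
  also have "\<dots> = ennreal (exp E) * (\<integral>\<^sup>+x. G t x \<partial>Pi\<^sub>M I M) + ennreal ?C"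
    by (simp add: nn_integral_add nn_integral_cmult nn_integral_likelihood)
  finally show ?thesis .
qed

end

section \<open>Hybrid runs of DP-ADMM\<close>

definition with_data ::
  "('d::finite, 'p::finite) dp_admm \<Rightarrow> nat \<Rightarrow> ('d, 'p) dataset \<Rightarrow> ('d, 'p) dp_admm" where
  "with_data P i Di = P\<lparr>data := (data P)(i := Di)\<rparr>"

lemma with_data_simps [simp]:
  "agents (with_data P i Di) = agents P" "penalty (with_data P i Di) = penalty P"
  "step (with_data P i Di) = step P" "data (with_data P i Di) = (data P)(i := Di)"
  "init_global (with_data P i Di) = init_global P" "init_local (with_data P i Di) = init_local P"
  "init_dual (with_data P i Di) = init_dual P"
  "local_obj (with_data P i Di) = local_obj P" "local_obj_sub (with_data P i Di) = local_obj_sub P"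
  by (simp_all add: with_data_def local_obj_def local_obj_sub_def fun_eq_iff)

definition local_update ::
  "('d::finite, 'p::finite) dp_admm \<Rightarrow> nat \<Rightarrow> nat \<Rightarrow>
   ('d, 'p) model \<times> (nat \<Rightarrow> ('d, 'p) model) \<times> (nat \<Rightarrow> ('d, 'p) model) \<Rightarrow> ('d, 'p) model" where
  "local_update P k i s =
     arg_min (\<lambda>wi. approx_lagrangian P k i wi (fst (snd s) i) (fst s) (snd (snd s) i)) (\<lambda>_. True)"

text \<open>The part of an iteration that reads no dataset; an exchange of data is thereby confined
  to \<open>local_update\<close>.\<close>

definition admm_mix ::
  "('d::finite, 'p::finite) dp_admm \<Rightarrow> (nat \<Rightarrow> ('d, 'p) model) \<Rightarrow> (nat \<Rightarrow> ('d, 'p) model) \<Rightarrow>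
   ('d, 'p) model \<times> (nat \<Rightarrow> ('d, 'p) model) \<times> (nat \<Rightarrow> ('d, 'p) model)" where
  "admm_mix P \<gamma> wt =
     (let w = (1 / real (agents P)) *\<^sub>R (\<Sum>i=1..agents P. wt i)
              - (1 / real (agents P)) *\<^sub>R (\<Sum>i=1..agents P. (1 / penalty P) *\<^sub>R \<gamma> i)
      in (w, wt, \<lambda>i. \<gamma> i - penalty P *\<^sub>R (wt i - w)))"

text \<open>The state of DP-ADMM when agent \<open>i\<close> uses the dataset \<open>D k\<close> in iteration \<open>k\<close>.\<close>

primrec hybrid_state ::
  "('d::finite, 'p::finite) dp_admm \<Rightarrow> nat \<Rightarrow> (nat \<Rightarrow> ('d, 'p) dataset) \<Rightarrow>
   (nat \<times> nat \<Rightarrow> ('d, 'p) model) \<Rightarrow> nat \<Rightarrow>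
   ('d, 'p) model \<times> (nat \<Rightarrow> ('d, 'p) model) \<times> (nat \<Rightarrow> ('d, 'p) model)" where
  "hybrid_state P i D \<xi> 0 = (init_global P, init_local P, init_dual P)"
| "hybrid_state P i D \<xi> (Suc k) =
     admm_mix P (snd (snd (hybrid_state P i D \<xi> k)))
       (\<lambda>j. local_update (with_data P i (D (Suc k))) (Suc k) j (hybrid_state P i D \<xi> k) + \<xi> (j, Suc k))"

lemma dp_admm_state_with_data:
  "dp_admm_state (with_data P i Di) \<xi> k = hybrid_state P i (\<lambda>_. Di) \<xi> k"
  by (induction k) (simp_all add: admm_mix_def local_update_def Let_def case_prod_beta)

text \<open>Causality of the run, from which the adaptedness of \<open>round_shift\<close>
  follows.\<close>

lemma hybrid_state_cong:
  assumes "\<And>l. l \<le> k \<Longrightarrow> D l = D' l" "\<And>j l. l \<le> k \<Longrightarrow> \<xi> (j, l) = \<xi>' (j, l)"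
  shows "hybrid_state P i D \<xi> k = hybrid_state P i D' \<xi>' k"
  using assms by (induction k) simp_all

lemma local_update_other_agent:
  "j \<noteq> i \<Longrightarrow> local_update (with_data P i Di) k j s = local_update P k j s"
  by (simp add: local_update_def approx_lagrangian_def)

text \<open>The common state comes from a run with \<open>D'\<close>, because the exchange proceeds
  from the first iteration onwards. \<open>k\<close> counts completed iterations, so the displaced
  noise is that of iteration \<open>Suc k\<close>.\<close>

definition round_shift ::
  "('d::finite, 'p::finite) dp_admm \<Rightarrow> nat \<Rightarrow> ('d, 'p) dataset \<Rightarrow> ('d, 'p) dataset \<Rightarrow> nat \<Rightarrow>
   (nat \<times> nat \<Rightarrow> ('d, 'p) model) \<Rightarrow> ('d, 'p) model" where
  "round_shift P i D D' k \<xi> =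
     local_update (with_data P i D) (Suc k) i (hybrid_state P i (\<lambda>_. D') \<xi> k)
     - local_update (with_data P i D') (Suc k) i (hybrid_state P i (\<lambda>_. D') \<xi> k)"

text \<open>Exchanging the dataset in a single iteration amounts to shifting the noise of that iteration.\<close>

lemma hybrid_state_shift:
  "hybrid_state P i (\<lambda>l. if l \<le> K then D' else D) \<xi> k
   = hybrid_state P i (\<lambda>l. if l \<le> Suc K then D' else D)
       (\<xi>((i, Suc K) := \<xi> (i, Suc K) + round_shift P i D D' K \<xi>)) k"
proof (induction k)
  case 0
  then show ?case by simp
next
  case (Suc k)
  let ?D = "\<lambda>K l. if l \<le> K then D' else D"
  let ?\<xi> = "\<xi>((i, Suc K) := \<xi> (i, Suc K) + round_shift P i D D' K \<xi>)"
  have "local_update (with_data P i (?D K (Suc k))) (Suc k) j (hybrid_state P i (?D K) \<xi> k) + \<xi> (j, Suc k)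
      = local_update (with_data P i (?D (Suc K) (Suc k))) (Suc k) j (hybrid_state P i (?D K) \<xi> k) + ?\<xi> (j, Suc k)"
    for j
  \<comment> \<open>Only agent \<open>i\<close> in iteration \<open>Suc K\<close> sees a different
    dataset and a different noise, and the two changes cancel. Up to iteration \<open>K\<close> the
    run has used \<open>D'\<close> alone.\<close>
  proof (cases "k = K \<and> j = i")
    case True
    moreover have "hybrid_state P i (\<lambda>_. D') \<xi> K = hybrid_state P i (?D K) \<xi> K"
      by (rule hybrid_state_cong) auto
    ultimately show ?thesis by (simp add: round_shift_def)
  next
    case False
    then show ?thesis by (cases "j = i") (auto simp: local_update_other_agent)
  qed
  then show ?case
    using Suc by (simp only: hybrid_state.simps)
qed

section \<open>Closed form of the local update and its sensitivity to the data\<close>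

text \<open>The hypothesis says that the gradient in \<open>x\<close> vanishes at \<open>y\<close>;
  the Hessian is \<open>a + b\<close> times the identity, so this is the exact second-order
  expansion about \<open>y\<close>.\<close>

lemma quadratic_completion:
  fixes x y u w g \<gamma> :: "'a::real_inner"
  assumes "(a + b) *\<^sub>R y = \<gamma> + a *\<^sub>R w + b *\<^sub>R u - g"
  shows "g \<bullet> (x - u) - \<gamma> \<bullet> (x - w) + a / 2 * (norm (x - w))\<^sup>2 + b / 2 * (norm (x - u))\<^sup>2
       = g \<bullet> (y - u) - \<gamma> \<bullet> (y - w) + a / 2 * (norm (y - w))\<^sup>2 + b / 2 * (norm (y - u))\<^sup>2
         + (a + b) / 2 * (norm (x - y))\<^sup>2"
proof -
  have g: "g = \<gamma> + a *\<^sub>R w + b *\<^sub>R u - a *\<^sub>R y - b *\<^sub>R y"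
    using assms by (simp add: algebra_simps)
  show ?thesis
    unfolding g power2_norm_eq_inner
    by (simp add: inner_diff_left inner_diff_right inner_add_left inner_add_right
        inner_commute field_simps)
qed

text \<open>\<open>arg_min\<close> is a choice operator, so uniqueness of the minimizer is
  essential. It follows because the objective exceeds its value at \<open>y\<close> by a positive
  multiple of the squared distance.\<close>

lemma local_update_eq:
  assumes "penalty P > 0" "step P i k > 0"
  shows "local_update P k i (w, wt, \<gamma>) = (1 / (penalty P + 1 / step P i k)) *\<^sub>R
    (\<gamma> i + penalty P *\<^sub>R w + (1 / step P i k) *\<^sub>R wt i - local_obj_sub P (data P i) (wt i))"
    (is "_ = ?y")
proof -
  let ?a = "penalty P" and ?b = "1 / step P i k"
  let ?L = "\<lambda>wi. approx_lagrangian P k i wi (wt i) w (\<gamma> i)"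
  define y where "y = ?y"
  have pos: "?a + ?b > 0" using assms by (simp add: add_pos_pos)
  then have "(?a + ?b) *\<^sub>R y = \<gamma> i + ?a *\<^sub>R w + ?b *\<^sub>R wt i - local_obj_sub P (data P i) (wt i)"
    by (simp add: y_def)
  note completion = quadratic_completion[OF this]
  have scale: "r / (2 * step P i k) = ?b / 2 * r" for r by simp
  have L: "?L x = ?L y + (?a + ?b) / 2 * (norm (x - y))\<^sup>2" for x
    using completion[of x] unfolding approx_lagrangian_def scale by linarith
  have min: "is_arg_min ?L (\<lambda>_. True) x \<longleftrightarrow> x = y" for x
  proof
    assume "is_arg_min ?L (\<lambda>_. True) x"
    then have "?L x \<le> ?L y" by (auto simp: is_arg_min_def not_less)
    then have "(?a + ?b) / 2 * (norm (x - y))\<^sup>2 \<le> 0" using L[of x] by linarith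
    then show "x = y" using pos by (simp add: mult_le_0_iff)
  next
    assume "x = y"
    moreover have "?L y \<le> ?L z" for z
    proof -
      have "0 \<le> (?a + ?b) / 2 * (norm (z - y))\<^sup>2" using pos by simp
      with L[of z] show ?thesis by linarith
    qed
    ultimately show "is_arg_min ?L (\<lambda>_. True) x"
      by (simp add: is_arg_min_def not_less)
  qed
  show ?thesis
    by (simp add: local_update_def arg_min_def min flip: y_def)
qed

lemma dp_admm_settingD:
  assumes "dp_admm_setting P"
  shows "penalty P > 0" "\<And>i k. i \<in> {1..agents P} \<Longrightarrow> 1 \<le> k \<Longrightarrow> step P i k > 0"
    "\<And>Di. local_obj_sub P Di \<in> borel_measurable borel"
proof -
  show "local_obj_sub P Di \<in> borel_measurable borel" for Di
    using assms unfolding dp_admm_setting_def local_obj_sub_def[abs_def]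
    by (intro borel_measurable_add borel_measurable_sum borel_measurable_scaleR borel_measurable_const) auto
qed (use assms in \<open>auto simp: dp_admm_setting_def\<close>)

text \<open>The regularizer cancels and only the summand of the exchanged tuple survives, a
  difference of two subgradients bounded by \<open>c1\<close>.\<close>

lemma norm_local_obj_sub_diff_le:
  assumes "neighbouring D D'" and l: "\<And>a b w. norm (loss_sub P a b w) \<le> c1"
  shows "norm (local_obj_sub P D' w - local_obj_sub P D w) \<le> 2 * c1 / real (length D)"
proof -
  obtain j z where j: "j < length D" and D': "D' = D[j := z]"
    using assms(1) by (auto simp: neighbouring_def)
  let ?g = "\<lambda>z. loss_sub P (fst z) (snd z) w"
  have "local_obj_sub P D' w - local_obj_sub P D w
      = (\<Sum>k<length D. if k = j then (1 / real (length D)) *\<^sub>R (?g z - ?g (D ! j)) else 0)"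
    unfolding local_obj_sub_def D' length_list_update add_diff_cancel_right sum_subtractf[symmetric]
    by (rule sum.cong) (auto simp: scaleR_diff_right)
  then have "norm (local_obj_sub P D' w - local_obj_sub P D w) = norm (?g z - ?g (D ! j)) / real (length D)"
    using j by (simp add: divide_inverse)
  also have "\<dots> \<le> (c1 + c1) / real (length D)"
    using norm_triangle_ineq4[of "?g z" "?g (D ! j)"] l[of "fst z" "snd z" w] l[of "fst (D ! j)" "snd (D ! j)" w]
    by (intro divide_right_mono) linarith+
  finally show ?thesis by simp
qed

text \<open>Both updates start from the same state, so in the closed form everything but the
  subgradients cancels.\<close>

lemma norm_round_shift_le:
  assumes P: "dp_admm_setting P" and i: "i \<in> {1..agents P}"
    and D: "neighbouring D D'" and l: "\<And>a b w. norm (loss_sub P a b w) \<le> c1"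
  shows "norm (round_shift P i D D' k \<xi>)
    \<le> 2 * c1 / (real (length D) * (penalty P + 1 / step P i (Suc k)))"
proof -
  let ?s = "penalty P + 1 / step P i (Suc k)"
  obtain w wt \<gamma> where s: "hybrid_state P i (\<lambda>_. D') \<xi> k = (w, wt, \<gamma>)"
    by (cases "hybrid_state P i (\<lambda>_. D') \<xi> k") auto
  note pos = dp_admm_settingD(1)[OF P] dp_admm_settingD(2)[OF P i, of "Suc k"]
  have s_pos: "?s > 0" using pos by (simp add: add_pos_pos)
  have "round_shift P i D D' k \<xi> = (1 / ?s) *\<^sub>R (local_obj_sub P D' (wt i) - local_obj_sub P D (wt i))"
    using pos by (simp add: round_shift_def s local_update_eq flip: scaleR_diff_right)
  then have "norm (round_shift P i D D' k \<xi>) = norm (local_obj_sub P D' (wt i) - local_obj_sub P D (wt i)) / ?s"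
    using s_pos by (simp add: divide_inverse)
  also have "\<dots> \<le> 2 * c1 / real (length D) / ?s"
    using norm_local_obj_sub_diff_le[OF D l] s_pos by (intro divide_right_mono) auto
  finally show ?thesis by simp
qed

section \<open>Measurability of the runs\<close>

lemma measurable_local_update:
  assumes P: "dp_admm_setting P" and j: "j \<in> {1..agents P}" and k: "1 \<le> k"
    and [measurable]: "(\<lambda>\<xi>. fst (s \<xi>)) \<in> borel_measurable N"
      "(\<lambda>\<xi>. fst (snd (s \<xi>)) j) \<in> borel_measurable N"
      "(\<lambda>\<xi>. snd (snd (s \<xi>)) j) \<in> borel_measurable N"
  shows "(\<lambda>\<xi>. local_update (with_data P i Di) k j (s \<xi>)) \<in> borel_measurable N"
proof -
  note [measurable] = dp_admm_settingD(3)[OF P]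
  note pos = dp_admm_settingD(1)[OF P] dp_admm_settingD(2)[OF P j k]
  have "local_update (with_data P i Di) k j s' = (1 / (penalty P + 1 / step P j k)) *\<^sub>R
      (snd (snd s') j + penalty P *\<^sub>R fst s' + (1 / step P j k) *\<^sub>R fst (snd s') j
       - local_obj_sub P (((data P)(i := Di)) j) (fst (snd s') j))" for s'
    using local_update_eq[of "with_data P i Di" j k "fst s'" "fst (snd s')" "snd (snd s')"] pos by simp
  then show ?thesis by simp
qed

text \<open>The claim is limited to agents in range, for which the steps are positive and the noise
  is assumed measurable.\<close>

lemma measurable_hybrid_state:
  assumes P: "dp_admm_setting P"
    and \<xi>: "\<And>j k. j \<in> {1..agents P} \<Longrightarrow> k \<in> {1..t} \<Longrightarrow> (\<lambda>\<xi>. \<xi> (j, k)) \<in> borel_measurable N"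
  shows "k \<le> t \<Longrightarrow> (\<lambda>\<xi>. fst (hybrid_state P i D \<xi> k)) \<in> borel_measurable N \<and>
    (\<forall>j\<in>{1..agents P}. (\<lambda>\<xi>. fst (snd (hybrid_state P i D \<xi> k)) j) \<in> borel_measurable N \<and>
       (\<lambda>\<xi>. snd (snd (hybrid_state P i D \<xi> k)) j) \<in> borel_measurable N)"
proof (induction k)
  case 0
  then show ?case by simp
next
  case (Suc k)
  let ?wt = "\<lambda>\<xi> j. local_update (with_data P i (D (Suc k))) (Suc k) j (hybrid_state P i D \<xi> k) + \<xi> (j, Suc k)"
  have wt: "(\<lambda>\<xi>. ?wt \<xi> j) \<in> borel_measurable N" if "j \<in> {1..agents P}" for j
    using Suc that by (intro borel_measurable_add measurable_local_update[OF P] \<xi>) auto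
  have \<gamma>: "(\<lambda>\<xi>. snd (snd (hybrid_state P i D \<xi> k)) j) \<in> borel_measurable N"
    if "j \<in> {1..agents P}" for j
    using Suc that by auto
  have w: "(\<lambda>\<xi>. fst (hybrid_state P i D \<xi> (Suc k))) \<in> borel_measurable N"
    unfolding hybrid_state.simps admm_mix_def Let_def fst_conv
    using wt \<gamma> by (intro borel_measurable_diff borel_measurable_scaleR borel_measurable_sum) auto
  moreover have "(\<lambda>\<xi>. snd (snd (hybrid_state P i D \<xi> (Suc k))) j) \<in> borel_measurable N"
    if j: "j \<in> {1..agents P}" for j
  proof -
    have "snd (snd (hybrid_state P i D \<xi> (Suc k))) j = snd (snd (hybrid_state P i D \<xi> k)) j
        - penalty P *\<^sub>R (?wt \<xi> j - fst (hybrid_state P i D \<xi> (Suc k)))" for \<xi>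
      by (simp add: admm_mix_def Let_def)
    then show ?thesis
      using \<gamma>[OF j] wt[OF j] w by simp
  qed
  moreover have "(\<lambda>\<xi>. fst (snd (hybrid_state P i D \<xi> (Suc k))) j) \<in> borel_measurable N"
    if j: "j \<in> {1..agents P}" for j
    using wt[OF j] by (simp add: admm_mix_def Let_def)
  ultimately show ?case by blast
qed

section \<open>Privacy\<close>

lemma sets_gaussian_matrix [simp, measurable_cong]: "sets (gaussian_matrix \<sigma>) = sets borel"
  by (simp add: gaussian_matrix_def)

text \<open>Instance of \<open>nn_integral_hybrid_le\<close> in which \<open>G K\<close> indicates
  that the run with \<open>D'\<close> in the first \<open>K\<close> iterations and \<open>D\<close>
  afterwards has its output in \<open>S\<close>.\<close>

lemma dp_admm_likelihood_bound:
  fixes P :: "('d::finite, 'p::finite) dp_admm"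
  assumes P: "dp_admm_setting P" and i: "i \<in> {1..agents P}"
    and D: "neighbouring D D'" and l: "\<And>a b w. norm (loss_sub P a b w) \<le> c1"
    and noise: "\<And>k. k < t \<Longrightarrow>
      2 * c1 / (real (length D) * (penalty P + 1 / step P i (Suc k))) \<le> \<mu> * \<bar>\<sigma> i (Suc k)\<bar>"
    and s: "0 \<le> s" and S: "S \<in> sets (dp_admm_mechanism P \<sigma> t i D)"
  shows "measure (dp_admm_mechanism P \<sigma> t i D) S \<le> exp E * measure (dp_admm_mechanism P \<sigma> t i D') S
    + exp (s * (s + 1) * (real t * \<mu>\<^sup>2 / 2) - s * E)"
proof -
  let ?M = "\<lambda>(i, k). gaussian_matrix (\<sigma> i k) :: ('d, 'p) model measure"
  let ?I = "{1..agents P} \<times> {1..t}"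
  let ?C = "exp (s * (s + 1) * (real t * \<mu>\<^sup>2 / 2) - s * E)"
  let ?B = "\<Pi>\<^sub>M k\<in>{1..t}. (borel :: ('d, 'p) model measure)"
  have N: "noise_space (agents P) \<sigma> t = Pi\<^sub>M ?I ?M" by (simp add: noise_space_def)
  have S_B: "S \<in> sets ?B" using S by (simp add: dp_admm_mechanism_def)
  have meas_\<xi>: "(\<lambda>\<xi>. \<xi> (j, k)) \<in> borel_measurable (Pi\<^sub>M ?I ?M)"
    if "j \<in> {1..agents P}" "k \<in> {1..t}" for j k
  proof -
    have "(\<lambda>\<xi>. \<xi> (j, k)) \<in> measurable (Pi\<^sub>M ?I ?M) (?M (j, k))"
      by (rule measurable_component_singleton) (use that in auto)
    then show ?thesis
      by (simp only: prod.case measurable_cong_sets[OF refl sets_gaussian_matrix])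
  qed
  note meas_state = measurable_hybrid_state[where N = "Pi\<^sub>M ?I ?M" and t = t, OF P meas_\<xi>]
  define out where "out D \<xi> = (\<lambda>k\<in>{1..t}. fst (snd (hybrid_state P i D \<xi> k)) i)" for D \<xi>
  have out [measurable]: "out D \<in> measurable (Pi\<^sub>M ?I ?M) ?B" for D
    unfolding out_def[abs_def] using meas_state i by (intro measurable_restrict) auto
  define hyb where "hyb K = (\<lambda>l. if l \<le> K then D' else D)" for K :: nat
  \<comment> \<open>Index 0 is never read, so \<open>hyb 0\<close>, although it is \<open>D'\<close>
    there, gives the run with \<open>D\<close>; likewise \<open>hyb t\<close> gives the run with
    \<open>D'\<close>.\<close>
  have out_cong: "out D1 = out D2" if "\<And>l. 1 \<le> l \<Longrightarrow> l \<le> t \<Longrightarrow> D1 l = D2 l" for D1 D2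
  proof -
    have "k \<le> t \<Longrightarrow> hybrid_state P i D1 \<xi> k = hybrid_state P i D2 \<xi> k" for k \<xi>
      using that by (induction k) simp_all
    then show ?thesis by (auto simp: out_def fun_eq_iff)
  qed
  have mech: "dp_admm_mechanism P \<sigma> t i Di = distr (Pi\<^sub>M ?I ?M) ?B (out (\<lambda>_. Di))" for Di
    unfolding dp_admm_mechanism_def N noisy_local_def out_def[abs_def]
    by (simp add: dp_admm_state_with_data flip: with_data_def)
  \<comment> \<open>Round \<open>k\<close> is iteration \<open>Suc k\<close> of agent
    \<open>i\<close>; the noise of the other agents stays in the product as untouched
    coordinates.\<close>
  interpret adaptive_gaussian ?M ?I "\<lambda>k. (i, Suc k)" "\<lambda>k. \<sigma> i (Suc k)" "round_shift P i D D'" t \<mu>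
  proof (rule adaptive_gaussian.intro)
    show "prob_space (?M jk)" for jk
      by (cases jk) (simp add: prob_space_gaussian_matrix)
    show "sets (?M jk) = sets borel" for jk by (cases jk) simp
    show "gaussian_shift (?M (i, Suc k)) (\<sigma> i (Suc k))" for k
      by (simp add: gaussian_shift_gaussian_matrix)
    show "(i, Suc k) \<in> ?I" if "k < t" for k using that i by auto
    show "round_shift P i D D' k \<in> borel_measurable (Pi\<^sub>M ?I ?M)" if "k < t" for k
      unfolding round_shift_def[abs_def] using that i meas_state[of k]
      by (intro borel_measurable_diff measurable_local_update[OF P]) auto
    \<comment> \<open>\<open>round_shift\<close> at \<open>k\<close> reads noise up to iteration
      \<open>k\<close> only, which is before \<open>Suc l\<close>.\<close>
    show "round_shift P i D D' k (\<xi>((i, Suc l) := y)) = round_shift P i D D' k \<xi>"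
      if "k \<le> l" for k l \<xi> y
    proof -
      have "hybrid_state P i (\<lambda>_. D') (\<xi>((i, Suc l) := y)) k = hybrid_state P i (\<lambda>_. D') \<xi> k"
        using that by (intro hybrid_state_cong) auto
      then show ?thesis by (simp add: round_shift_def)
    qed
    show "norm (round_shift P i D D' k \<xi>) \<le> \<mu> * \<bar>\<sigma> i (Suc k)\<bar>" if "k < t" for k \<xi>
      using norm_round_shift_le[OF P i D l] noise[OF that] by (rule order_trans)
  qed auto
  let ?G = "\<lambda>K \<xi>. indicator S (out (hyb K) \<xi>) :: ennreal"
  have "(\<integral>\<^sup>+\<xi>. ?G 0 \<xi> \<partial>Pi\<^sub>M ?I ?M) \<le> ennreal (exp E) * (\<integral>\<^sup>+\<xi>. ?G t \<xi> \<partial>Pi\<^sub>M ?I ?M) + ennreal ?C"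
  proof (rule nn_integral_hybrid_le)
    show "?G K \<in> borel_measurable (Pi\<^sub>M ?I ?M)" for K
      using out S_B by (rule measurable_compose[OF _ borel_measurable_indicator])
    show "?G K \<xi> = ?G (Suc K) (\<xi>((i, Suc K) := \<xi> (i, Suc K) + round_shift P i D D' K \<xi>))" for K \<xi>
      unfolding out_def hyb_def hybrid_state_shift[of P i K D' D \<xi>] ..
    show "?G t \<xi> \<le> 1" for \<xi> by (simp add: indicator_def)
  qed (rule s)
  moreover have "emeasure (dp_admm_mechanism P \<sigma> t i Di) S = (\<integral>\<^sup>+\<xi>. indicator S (out (\<lambda>_. Di) \<xi>) \<partial>Pi\<^sub>M ?I ?M)" for Di
  proof -
    have "emeasure (dp_admm_mechanism P \<sigma> t i Di) S = (\<integral>\<^sup>+y. indicator S y \<partial>dp_admm_mechanism P \<sigma> t i Di)"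
      using S_B by (simp add: mech)
    also have "\<dots> = (\<integral>\<^sup>+\<xi>. indicator S (out (\<lambda>_. Di) \<xi>) \<partial>Pi\<^sub>M ?I ?M)"
      unfolding mech using S_B by (intro nn_integral_distr out) simp
    finally show ?thesis .
  qed
  moreover have "out (hyb 0) = out (\<lambda>_. D)" "out (hyb t) = out (\<lambda>_. D')"
    by (rule out_cong; simp add: hyb_def)+
  ultimately have "emeasure (dp_admm_mechanism P \<sigma> t i D) S
      \<le> ennreal (exp E) * emeasure (dp_admm_mechanism P \<sigma> t i D') S + ennreal ?C"
    by simp
  moreover have "prob_space (dp_admm_mechanism P \<sigma> t i Di)" for Di
    unfolding mech by (rule prob_space_distr[OF out])
  then have "emeasure (dp_admm_mechanism P \<sigma> t i Di) S = ennreal (measure (dp_admm_mechanism P \<sigma> t i Di) S)" for Di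
    by (simp add: prob_space.finite_measure finite_measure.emeasure_eq_measure)
  ultimately show ?thesis
    by (simp flip: ennreal_mult ennreal_plus)
qed

section \<open>Calibration of the parameters\<close>

text \<open>With \<open>r = sqrt (real t) * \<epsilon>\<close> and
  \<open>L = ln (1.25 / \<delta>)\<close>, privacy needs \<open>E\<close> to dominate
  \<open>r + r * r / (4 * L)\<close>. Assumption \<open>B\<close> makes the quadratic term at most
  \<open>\<bar>B\<bar> * r / 4\<close>, hence linear in \<open>r\<close>.\<close>

lemma dp_admm_private_noise_level:
  fixes P :: "('d::finite, 'p::finite) dp_admm"
  assumes P: "dp_admm_setting P" and l: "\<And>a b w. norm (loss_sub P a b w) \<le> c1"
    and \<epsilon>: "0 < \<epsilon>" and \<delta>: "0 < \<delta>" "\<delta> < 1"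
    and B: "sqrt (real t) * \<epsilon> \<le> B * ln (1.25 / \<delta>)"
  shows "dp_admm_private P (noise_level P c1 \<epsilon> \<delta>) t ((1 + \<bar>B\<bar> / 4) * sqrt (real t) * \<epsilon>) \<delta>"
  unfolding dp_admm_private_def differentially_private_def
proof (intro ballI impI)
  fix i D D' S
  assume i: "i \<in> {1..agents P}" and len: "D \<in> {Di. length Di = length (data P i)}"
    and D: "neighbouring D D'" and S: "S \<in> sets (dp_admm_mechanism P (noise_level P c1 \<epsilon> \<delta>) t i D)"
  let ?\<sigma> = "noise_level P c1 \<epsilon> \<delta>"
  define L where "L = ln (1.25 / \<delta>)"
  define r where "r = sqrt (real t) * \<epsilon>"
  define E where "E = (1 + \<bar>B\<bar> / 4) * sqrt (real t) * \<epsilon>"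
  have L: "L > 0" using \<delta> by (simp add: L_def)
  have c1: "c1 \<ge> 0" using l norm_ge_zero order_trans by blast
  show "measure (dp_admm_mechanism P ?\<sigma> t i D) S \<le> exp E * measure (dp_admm_mechanism P ?\<sigma> t i D') S + \<delta>"
  \<comment> \<open>For \<open>t = 0\<close> the divisor \<open>r\<close> of \<open>s\<close>
    vanishes; nothing is output, so the two laws coincide.\<close>
  proof (cases "t = 0")
    case True
    then have "dp_admm_mechanism P ?\<sigma> t i D = dp_admm_mechanism P ?\<sigma> t i D'"
      by (simp add: dp_admm_mechanism_def restrict_def)
    then show ?thesis using True \<delta> by (simp add: E_def)
  next
    case False
    then have r: "r > 0" using \<epsilon> by (simp add: r_def)
    define \<mu> where "\<mu> = \<epsilon> / sqrt (2 * L)"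
    \<comment> \<open>chosen so that \<open>s\<^sup>2 * (real t * \<mu>\<^sup>2 / 2) = L\<close>\<close>
    define s where "s = 2 * L / r"
    have \<mu>2: "real t * \<mu>\<^sup>2 / 2 = r\<^sup>2 / (4 * L)"
      using L by (simp add: \<mu>_def r_def power_mult_distrib power_divide)
    have "2 * c1 / (real (length D) * (penalty P + 1 / step P i (Suc k))) \<le> \<mu> * \<bar>?\<sigma> i (Suc k)\<bar>" for k
    proof -
      \<comment> \<open>This fixes \<open>\<mu>\<close>: its factors \<open>\<epsilon>\<close> and
        \<open>sqrt (2 * L)\<close> cancel those of the noise level, so no other parameter of the
        problem survives.\<close>
      have "2 * c1 / (real (length D) * (penalty P + 1 / step P i (Suc k))) = \<mu> * ?\<sigma> i (Suc k)"
      proof -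
        have "?\<sigma> i (Suc k) = 2 * c1 * sqrt (2 * L) / (real (length D) * \<epsilon> * (penalty P + 1 / step P i (Suc k)))"
          using len by (simp add: noise_level_def L_def)
        then show ?thesis using L \<epsilon> by (simp add: \<mu>_def)
      qed
      also have "\<dots> \<le> \<mu> * \<bar>?\<sigma> i (Suc k)\<bar>"
        using L \<epsilon> by (intro mult_left_mono) (auto simp: \<mu>_def)
      finally show ?thesis .
    qed
    then have "measure (dp_admm_mechanism P ?\<sigma> t i D) S \<le> exp E * measure (dp_admm_mechanism P ?\<sigma> t i D') S
        + exp (s * (s + 1) * (real t * \<mu>\<^sup>2 / 2) - s * E)"
      using L r by (intro dp_admm_likelihood_bound[OF P i D l _ _ S]) (simp_all add: s_def)
    \<comment> \<open>The exponent equals \<open>L + r / 2 - 2 * L - \<bar>B\<bar> * L / 2\<close>,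
      and \<open>r \<le> \<bar>B\<bar> * L\<close>.\<close>
    also have "exp (s * (s + 1) * (real t * \<mu>\<^sup>2 / 2) - s * E) \<le> exp (- L)"
    proof -
      have "r \<le> \<bar>B\<bar> * L"
        using B L abs_ge_self[of B] unfolding r_def[symmetric] L_def[symmetric]
        by (meson less_imp_le mult_right_mono order_trans)
      moreover have "s * (s + 1) * (real t * \<mu>\<^sup>2 / 2) = L + r / 2"
        unfolding \<mu>2 s_def using L r by (simp add: field_simps power2_eq_square)
      moreover have "s * E = 2 * L + \<bar>B\<bar> * L / 2"
        using r by (simp add: s_def E_def mult.assoc flip: r_def) (simp add: field_simps)
      ultimately have "s * (s + 1) * (real t * \<mu>\<^sup>2 / 2) - s * E \<le> - L" by linarith
      then show ?thesis by simp
    qed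
    \<comment> \<open>In fact \<open>exp (- L) = \<delta> / 1.25\<close>.\<close>
    also have "exp (- L) \<le> \<delta>"
      using \<delta> by (simp add: L_def exp_minus field_simps)
    finally show ?thesis by simp
  qed
qed

(* A constant c0 independent of all parameters does not exist: for fixed eps and delta the
   t-fold composition of Gaussian mechanisms loses privacy linearly in t. The first part lets
   c0 depend on t only; in the second part c0 is also uniform in t, as long as
   sqrt t * eps / ln (1.25 / delta) stays bounded, and every choice of t, eps and delta
   satisfies that bound for some B. *)
theorem theorem2:
  "(\<forall>t::nat. \<exists>c0>0. \<forall>(P :: ('d::finite, 'p::finite) dp_admm) c1 \<epsilon> \<delta>.
      dp_admm_setting P \<longrightarrow> (\<forall>a b w. norm (loss_sub P a b w) \<le> c1) \<longrightarrow>
      0 < \<epsilon> \<longrightarrow> \<epsilon> \<le> 1 \<longrightarrow> 0 < \<delta> \<longrightarrow> \<delta> < 1 \<longrightarrow>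
      dp_admm_private P (noise_level P c1 \<epsilon> \<delta>) t (c0 * sqrt (real t) * \<epsilon>) \<delta>) \<and>
   (\<forall>B::real. \<exists>c0>0. \<forall>(t::nat) (P :: ('d, 'p) dp_admm) c1 \<epsilon> \<delta>.
      dp_admm_setting P \<longrightarrow> (\<forall>a b w. norm (loss_sub P a b w) \<le> c1) \<longrightarrow>
      0 < \<epsilon> \<longrightarrow> \<epsilon> \<le> 1 \<longrightarrow> 0 < \<delta> \<longrightarrow> \<delta> < 1 \<longrightarrow>
      sqrt (real t) * \<epsilon> \<le> B * ln (1.25 / \<delta>) \<longrightarrow>
      dp_admm_private P (noise_level P c1 \<epsilon> \<delta>) t (c0 * sqrt (real t) * \<epsilon>) \<delta>)"
proof (intro conjI allI)
  fix t :: nat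
  \<comment> \<open>For fixed \<open>t\<close> the bound with \<open>?B\<close> is automatic:
    \<open>\<epsilon> \<le> 1\<close>, and \<open>\<delta> < 1\<close> keeps
    \<open>ln (1.25 / \<delta>)\<close> above \<open>ln 1.25\<close>.\<close>
  let ?B = "sqrt (real t) / ln 1.25"
  have B: "sqrt (real t) * \<epsilon> \<le> ?B * ln (1.25 / \<delta>)" if "\<epsilon> \<le> 1" "0 < \<delta>" "\<delta> < 1" for \<epsilon> \<delta> :: real
  proof -
    have "ln 1.25 > (0::real)" by simp
    moreover have "ln 1.25 \<le> ln (1.25 / \<delta>)"
      using that by (subst ln_le_cancel_iff) (auto simp: field_simps)
    ultimately have "1 \<le> ln (1.25 / \<delta>) / ln 1.25" by simp
    with \<open>\<epsilon> \<le> 1\<close> have "\<epsilon> \<le> ln (1.25 / \<delta>) / ln 1.25" by linarith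
    then have "sqrt (real t) * \<epsilon> \<le> sqrt (real t) * (ln (1.25 / \<delta>) / ln 1.25)"
      by (rule mult_left_mono) simp
    then show ?thesis by (simp only: times_divide_eq_left times_divide_eq_right)
  qed
  show "\<exists>c0>0. \<forall>(P :: ('d, 'p) dp_admm) c1 \<epsilon> \<delta>.
      dp_admm_setting P \<longrightarrow> (\<forall>a b w. norm (loss_sub P a b w) \<le> c1) \<longrightarrow>
      0 < \<epsilon> \<longrightarrow> \<epsilon> \<le> 1 \<longrightarrow> 0 < \<delta> \<longrightarrow> \<delta> < 1 \<longrightarrow>
      dp_admm_private P (noise_level P c1 \<epsilon> \<delta>) t (c0 * sqrt (real t) * \<epsilon>) \<delta>"
  proof (intro exI[of _ "1 + \<bar>?B\<bar> / 4"] conjI allI impI)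
    show "0 < 1 + \<bar>?B\<bar> / 4" by (simp only: add_pos_nonneg zero_less_one abs_ge_zero divide_nonneg_pos zero_less_numeral)
  qed (rule dp_admm_private_noise_level, auto intro: B[simplified])
next
  fix B :: real
  show "\<exists>c0>0. \<forall>(t::nat) (P :: ('d, 'p) dp_admm) c1 \<epsilon> \<delta>.
      dp_admm_setting P \<longrightarrow> (\<forall>a b w. norm (loss_sub P a b w) \<le> c1) \<longrightarrow>
      0 < \<epsilon> \<longrightarrow> \<epsilon> \<le> 1 \<longrightarrow> 0 < \<delta> \<longrightarrow> \<delta> < 1 \<longrightarrow>
      sqrt (real t) * \<epsilon> \<le> B * ln (1.25 / \<delta>) \<longrightarrow>
      dp_admm_private P (noise_level P c1 \<epsilon> \<delta>) t (c0 * sqrt (real t) * \<epsilon>) \<delta>"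
  proof (intro exI[of _ "1 + \<bar>B\<bar> / 4"] conjI allI impI)
    show "0 < 1 + \<bar>B\<bar> / 4" by (simp add: add_pos_nonneg)
  qed (rule dp_admm_private_noise_level, auto)
qed

end
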